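(* For any nonzero ring $R$ and any natural number $n\ge 2$, the full matrix ring $M_n(R)$ of $n\times n$ matrices over $R$ is not a $W\Delta U$ ring.
   Context: Rings are associative with identity, not necessarily commutative. $U(S)$ is the group of units of a ring $S$. $\Delta(S)=\{r\in S : r+u\in U(S)\text{ for all }u\in U(S)\}$; equivalently $\Delta(S)=J(T)$, where $T$ is the subring of $S$ generated by $U(S)$ and $J$ denotes the Jacobson radical. A ring $S$ is $W\Delta U$ (weakly $\Delta U$) if $U(S)=\pm 1+\Delta(S)$, i.e. every unit of $S$ has the form $1+d$ or $-1+d$ with $d\in\Delta(S)$. *)

theory Defs
  imports "HOL-Algebra.Ring" "HOL-Algebra.AbelCoset" "Jordan_Normal_Form.Matrix"
begin

definition Delta :: "('a, 'b) ring_scheme \<Rightarrow> 'a set" where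
  "Delta S = {r \<in> carrier S. \<forall>u \<in> Units S. r \<oplus>\<^bsub>S\<^esub> u \<in> Units S}"

definition WDeltaU :: "('a, 'b) ring_scheme \<Rightarrow> bool" where
  "WDeltaU S \<longleftrightarrow> Units S = {\<one>\<^bsub>S\<^esub>, \<ominus>\<^bsub>S\<^esub> \<one>\<^bsub>S\<^esub>} <+>\<^bsub>S\<^esub> Delta S"

text \<open>The library fact \<open>ring_mat\<close> is stated for commutative coefficients only; square matrices
  over an arbitrary ring with identity form a ring as well.\<close>

lemma ring_mat_noncomm: "ring (ring_mat TYPE('a :: ring_1) n b)"
proof -
  interpret semiring "ring_mat TYPE('a) n b" by (rule semiring_mat)
  have inv: "\<exists>B \<in> carrier_mat n n. B + A = 0\<^sub>m n n \<and> A + B = 0\<^sub>m n n"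
    if "A \<in> carrier_mat n n" for A :: "'a mat"
    using that by (intro bexI[of _ "- A"]) (auto intro!: eq_matI)
  show ?thesis
    by (unfold_locales, insert inv, auto simp: ring_mat_def algebra_simps Units_def)
qed

lemma WDeltaU_iff:
  "WDeltaU S \<longleftrightarrow> Units S = {\<one>\<^bsub>S\<^esub> \<oplus>\<^bsub>S\<^esub> d | d. d \<in> Delta S} \<union> {\<ominus>\<^bsub>S\<^esub> \<one>\<^bsub>S\<^esub> \<oplus>\<^bsub>S\<^esub> d | d. d \<in> Delta S}"
  unfolding WDeltaU_def set_add_def' by auto

end

(* Embed 2 x 2 matrices into n x n ones by putting an identity block below them. The unit u with
   corner [[0,1],[1,1]] has the property that the corners of u - 1 and of u + 1 are invertible as
   well, namely [[-1,1],[1,0]] and [[1,1],[1,2]]. Hence u - 1 or u + 1 becomes a matrix with zero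
   first row, so a non-unit, after adding the unit with the negated corner; neither lies in Delta. *)
theory Submission
  imports Defs
begin

definition corner_mat :: "nat \<Rightarrow> 'a :: ring_1 \<Rightarrow> 'a \<Rightarrow> 'a \<Rightarrow> 'a \<Rightarrow> 'a mat" where
  "corner_mat n a b c d = mat n n (\<lambda>(i, j).
     if i = 0 then (if j = 0 then a else if j = 1 then b else 0)
     else if i = 1 then (if j = 0 then c else if j = 1 then d else 0)
     else if i = j then 1 else 0)"

lemma corner_mat_carrier [simp]: "corner_mat n a b c d \<in> carrier_mat n n"
  by (simp add: corner_mat_def)

lemma corner_mat_mult:
  assumes "n \<ge> 2"
  shows "corner_mat n a b c d * corner_mat n a' b' c' d' =
    corner_mat n (a * a' + b * c') (a * b' + b * d') (c * a' + d * c') (c * b' + d * d')"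
    (is "?A * ?B = ?C")
proof (rule eq_matI)
  fix i j
  assume "i < dim_row ?C" "j < dim_col ?C"
  then have ij: "i < n" "j < n"
    by (auto simp: corner_mat_def)
  have "(?A * ?B) $$ (i, j) = (\<Sum>k = 0..<n. ?A $$ (i, k) * ?B $$ (k, j))"
    using ij by (simp add: corner_mat_def scalar_prod_def)
  also have "{0..<n} = insert 0 (insert 1 {2..<n})"
    using assms by auto
  also have "(\<Sum>k\<in>insert 0 (insert 1 {2..<n}). ?A $$ (i, k) * ?B $$ (k, j)) =
      ?A $$ (i, 0) * ?B $$ (0, j) + ?A $$ (i, 1) * ?B $$ (1, j)
      + (\<Sum>k = 2..<n. ?A $$ (i, k) * ?B $$ (k, j))"
    by (simp add: add.assoc)
  \<comment> \<open>From index 2 on, both factors agree with the identity matrix, so only k = i can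
    contribute.\<close>
  also have "(\<Sum>k = 2..<n. ?A $$ (i, k) * ?B $$ (k, j)) =
      (\<Sum>k = 2..<n. if k = i then (if i = j then 1 else 0) else 0)"
    using ij by (intro sum.cong) (auto simp: corner_mat_def)
  also have "\<dots> = (if i \<ge> 2 \<and> i = j then 1 else 0)"
    using ij by (simp add: sum.delta)
  finally show "(?A * ?B) $$ (i, j) = ?C $$ (i, j)"
    using ij assms by (auto simp: corner_mat_def)
qed (auto simp: corner_mat_def)

lemma corner_mat_one: "n \<ge> 2 \<Longrightarrow> corner_mat n 1 0 0 1 = 1\<^sub>m n"
  by (rule eq_matI) (auto simp: corner_mat_def)

text \<open>The entries need not commute, so no determinant test is available. The eight equations
  say that the primed corner is a two-sided inverse; the identity blocks take care of
  themselves.\<close>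

lemma corner_mat_Units:
  fixes a b c d a' b' c' d' :: "'a :: ring_1"
  assumes "n \<ge> 2"
    and "a * a' + b * c' = 1" "a * b' + b * d' = 0" "c * a' + d * c' = 0" "c * b' + d * d' = 1"
    and "a' * a + b' * c = 1" "a' * b + b' * d = 0" "c' * a + d' * c = 0" "c' * b + d' * d = 1"
  shows "corner_mat n a b c d \<in> Units (ring_mat TYPE('a) n e)"
proof -
  have "corner_mat n a' b' c' d' * corner_mat n a b c d = 1\<^sub>m n"
    "corner_mat n a b c d * corner_mat n a' b' c' d' = 1\<^sub>m n"
    using assms by (simp_all add: corner_mat_mult corner_mat_one)
  then show ?thesis
    using corner_mat_carrier[of n a' b' c' d'] by (auto simp: Units_def ring_mat_def)
qed

text \<open>Row i of A * B vanishes for every B, whereas the identity has 1 at (i, i). Here the ring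
  being nonzero enters, through 0 \<noteq> 1 in \<open>ring_1\<close>.\<close>

lemma zero_row_not_Unit:
  fixes A :: "'a :: ring_1 mat"
  assumes "i < n" "\<And>j. j < n \<Longrightarrow> A $$ (i, j) = 0"
  shows "A \<notin> Units (ring_mat TYPE('a) n e)"
proof
  assume "A \<in> Units (ring_mat TYPE('a) n e)"
  then obtain B where carrier: "A \<in> carrier_mat n n" "B \<in> carrier_mat n n"
    and AB: "A * B = 1\<^sub>m n"
    by (auto simp: Units_def ring_mat_def)
  from carrier have "(A * B) $$ (i, i) = 0"
    using assms by (simp add: scalar_prod_def)
  with AB show False
    using assms(1) by simp
qed

text \<open>One row is enough to destroy invertibility of D + V, so the lower blocks of D and V
  never have to cancel.\<close>

lemma not_Delta_if_cancels_row:
  fixes D V :: "'a :: ring_1 mat"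
  assumes "V \<in> Units (ring_mat TYPE('a) n e)" "i < n"
    and "\<And>j. j < n \<Longrightarrow> D $$ (i, j) + V $$ (i, j) = 0"
  shows "D \<notin> Delta (ring_mat TYPE('a) n e)"
proof
  assume "D \<in> Delta (ring_mat TYPE('a) n e)"
  then have "D + V \<in> Units (ring_mat TYPE('a) n e)"
    using assms(1) by (auto simp: Delta_def ring_mat_def)
  moreover have "V \<in> carrier_mat n n"
    using assms(1) by (auto simp: Units_def ring_mat_def)
  ultimately show False
    using zero_row_not_Unit[of i n "D + V" e] assms(2,3) by auto
qed

text \<open>Turns the abstract negative of the identity in \<open>WDeltaU_iff\<close> into an
  entrywise one; uniqueness of additive inverses gives it.\<close>

lemma ring_mat_a_inv:
  fixes A :: "'a :: ring_1 mat"
  assumes "A \<in> carrier_mat n n"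
  shows "\<ominus>\<^bsub>ring_mat TYPE('a) n e\<^esub> A = - A"
proof -
  interpret ring "ring_mat TYPE('a) n e"
    by (rule ring_mat_noncomm)
  show ?thesis
    using assms by (intro minus_equality) (auto simp: ring_mat_def)
qed

theorem proposition2p15:
  fixes n :: nat
  assumes "n \<ge> 2"
  shows "\<not> WDeltaU (ring_mat TYPE('a :: ring_1) n ())"
proof
  let ?S = "ring_mat TYPE('a) n ()"
  let ?U = "corner_mat n 0 1 1 1 :: 'a mat"
  let ?V = "corner_mat n 1 (- 1) (- 1) 0 :: 'a mat"
  let ?W = "corner_mat n (- 1) (- 1) (- 1) (- 2) :: 'a mat"
  assume "WDeltaU ?S"
  \<comment> \<open>The corner g = [[0,1],[1,1]] satisfies g^2 = g + 1, so its inverse is g -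
    1.\<close>
  moreover have "?U \<in> Units ?S"
    using assms by (rule corner_mat_Units[where a' = "- 1" and b' = 1 and c' = 1 and d' = 0]) simp_all
  ultimately obtain D where D: "D \<in> Delta ?S" and "?U = 1\<^sub>m n + D \<or> ?U = - 1\<^sub>m n + D"
    by (auto simp: WDeltaU_iff ring_mat_a_inv ring_mat_simps)
  then consider "?U = 1\<^sub>m n + D" | "?U = - 1\<^sub>m n + D"
    by blast
  then show False
  proof cases
    case 1
    \<comment> \<open>The corner of \<open>?V\<close> is -(g - 1), the negative of the inverse of g;
      hence its inverse is -g.\<close>
    have "?V \<in> Units ?S"
      using assms
      by (rule corner_mat_Units[where a' = 0 and b' = "- 1" and c' = "- 1" and d' = "- 1"]) simp_all
    moreover have "D $$ (0, j) + ?V $$ (0, j) = 0" if "j < n" for j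
    proof -
      have "?U $$ (0, j) = 1\<^sub>m n $$ (0, j) + D $$ (0, j)"
        using that D by (subst 1) (auto simp: Delta_def ring_mat_simps)
      with that show ?thesis
        by (auto simp: corner_mat_def add_eq_0_iff split: if_splits)
    qed
    ultimately show False
      using not_Delta_if_cancels_row[of ?V n "()" 0 D] D assms by auto
  next
    case 2
    \<comment> \<open>The corner of \<open>?W\<close> is -(g + 1) = -g^2, with inverse -(g - 1)^2 =
      [[-2,1],[1,-1]].\<close>
    have "?W \<in> Units ?S"
      using assms
      by (rule corner_mat_Units[where a' = "- 2" and b' = 1 and c' = 1 and d' = "- 1"]) simp_all
    moreover have "D $$ (0, j) + ?W $$ (0, j) = 0" if "j < n" for j
    proof -
      have "?U $$ (0, j) = - (1\<^sub>m n $$ (0, j)) + D $$ (0, j)"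
        using that D by (subst 2) (auto simp: Delta_def ring_mat_simps)
      with that show ?thesis
        by (auto simp: corner_mat_def split: if_splits)
    qed
    ultimately show False
      using not_Delta_if_cancels_row[of ?W n "()" 0 D] D assms by auto
  qed
qed

end
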